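(* For every instance $I$ of SBMSm satisfying the standing assumptions below, $\sigma(\pi^* )\le 2\,\sigma(\pi)$, where $\pi^*$ is an optimal multi-round adaptive policy for $I$ and $\pi$ is an optimal partially adaptive policy for $I$. Equivalently, the budget-adaptivity gap of SBMSm is at most $2$.
   Context: An instance of SBMSm is $I=(T,B,V,H,(\mathcal P_t)_{t\in[T]},(f_t)_{t\in[T]})$: $T\ge2$ rounds; integer budget $B\ge0$; a finite set $V$ of $n\ge2$ items; each item $v$ has a set $H(v)$ of local states, $H=\prod_vH(v)$; at round $t$ a state $\eta_t\in H$ is drawn from $\mathcal P_t$, independently across rounds; $f_t:2^V\times H\to\mathbb R_{\ge0}$. Partial states: $\langle S,\eta\rangle=(\eta(v))_{v\in S}$, and $\langle S,\eta\rangle\preceq\langle S',\eta'\rangle$ iff $S\subseteq S'$ and $\eta,\eta'$ agree on $S$. A multi-round adaptive policy starts at round $1$ with all $S_t=\emptyset$; at each step it either selects an item $v\notin S_t$ of the current round $t$, adds it to $S_t$ and observes $\eta_t(v)$, or moves on to round $t+1$ (never returning); it stops when $t>T$ or $\sum_t|S_t|=B$; decisions may depend on all observations so far. Its value is $\sigma(\pi)=\mathbb E[\sum_t f_t(S_t,\eta_t)]$. A partially adaptive policy first fixes, without any observation, a budget vector $(b_1,\dots,b_T)$ of non-negative integers with $\sum_tb_t\le B$, and then at each round $t$ adaptively selects $b_t$ items. The budget-adaptivity gap of $I$ is $\sigma(\pi^* )/\sigma(\pi)$ with $\pi^*$ optimal adaptive and $\pi$ optimal partially adaptive; the gap of SBMSm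 is its supremum over instances. Let $\Delta_t(v\mid\langle S\rangle)=\mathbb E_{\eta\sim\mathcal P_t}[f_t(S\cup\{v\},\eta)-f_t(S,\eta)\mid\langle S\rangle\preceq\eta]$. Standing assumptions: (polynomial boundedness) there are $\lambda,\Lambda>0$ with $\Lambda,1/\lambda$ polynomial in the size of $I$, all marginal increments $f_t(S\cup\{v\},\eta)-f_t(S,\eta)\le\Lambda$, and $\mathbb E[f_t(\{v\},\eta_t)]\ge\lambda$ for some $t,v$; (monotonicity) $f_t(S,\eta)\le f_t(S',\eta)$ for $S\subseteq S'$; (adaptive submodularity) $\Delta_t(v\mid\langle S\rangle)\ge\Delta_t(v\mid\langle S'\rangle)$ whenever $\langle S\rangle\preceq\langle S'\rangle$; (strong adaptive submodularity) moreover, for every integer $k\ge1$, partial state $\langle S\rangle$ at round $t$, and adaptive selection $\tilde S\supseteq S$ of at most $k+|S|$ items made after observing $\langle S\rangle$, the optimal expected value of $f_t$ achievable by a single-round adaptive policy at round $t$ selecting $k$ items is at least $\mathbb E[f_t(\tilde S,\eta)-f_t(S,\eta)\mid\langle S\rangle\preceq\eta]$. *)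

theory Defs
  imports "HOL-Probability.Probability" "HOL-Computational_Algebra.Polynomial"
begin

section \<open>Instances\<close>

text \<open>
  Rounds are numbered \<open>1, \<dots>, rounds I\<close>.  A state is an element of the dependent product
  \<open>PiE (items I) (local_states I)\<close>.  State distributions are discrete (of countable, possibly
  infinite, support), so that conditioning on a partial state is elementary conditioning on an
  event of positive probability.
\<close>

record ('v, 's) sbmsm =
  rounds :: nat
  budget :: nat
  items :: "'v set"
  local_states :: "'v \<Rightarrow> 's set"
  state_dist :: "nat \<Rightarrow> ('v \<Rightarrow> 's) pmf"
  reward :: "nat \<Rightarrow> 'v set \<Rightarrow> ('v \<Rightarrow> 's) \<Rightarrow> real"

definition states :: "('v, 's) sbmsm \<Rightarrow> ('v \<Rightarrow> 's) set" where
  "states I = PiE (items I) (local_states I)"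

definition sbmsm_instance :: "('v, 's) sbmsm \<Rightarrow> bool" where
  "sbmsm_instance I \<longleftrightarrow>
     rounds I \<ge> 2 \<and> finite (items I) \<and> card (items I) \<ge> 2 \<and>
     (\<forall>t\<in>{1..rounds I}. set_pmf (state_dist I t) \<subseteq> states I) \<and>
     (\<forall>t\<in>{1..rounds I}. \<forall>S\<subseteq>items I. \<forall>\<eta>\<in>states I. reward I t S \<eta> \<ge> 0)"

definition joint_dist :: "('v, 's) sbmsm \<Rightarrow> (nat \<Rightarrow> 'v \<Rightarrow> 's) pmf" where
  "joint_dist I = Pi_pmf {1..rounds I} undefined (state_dist I)"


section \<open>Multi-round policies\<close>

text \<open>
  A (deterministic) adaptive policy is a decision tree.  The continuation of \<open>Select v\<close> is a
  function of the local state of \<open>v\<close> observed in the current round, so the node reached, and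
  hence the next decision, depends on all observations made so far.
\<close>

datatype ('v, 's) policy =
    Stop
  | Next_Round "('v, 's) policy"
  | Select 'v "'s \<Rightarrow> ('v, 's) policy"

text \<open>
  \<open>legal_from I \<pi> t S b\<close>: the tree \<open>\<pi>\<close> is a legal continuation in round \<open>t\<close> when \<open>S\<close> is the set of
  items selected so far in round \<open>t\<close> and \<open>b\<close> is the remaining budget.
\<close>

primrec legal_from ::
  "('v, 's) sbmsm \<Rightarrow> ('v, 's) policy \<Rightarrow> nat \<Rightarrow> 'v set \<Rightarrow> nat \<Rightarrow> bool" where
  "legal_from I Stop = (\<lambda>t S b. t > rounds I \<or> b = 0)"
| "legal_from I (Next_Round \<pi>) =
     (\<lambda>t S b. t \<le> rounds I \<and> b > 0 \<and> legal_from I \<pi> (Suc t) {} b)"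
| "legal_from I (Select v c) =
     (\<lambda>t S b. t \<le> rounds I \<and> b > 0 \<and> v \<in> items I - S \<and>
        (\<forall>s\<in>local_states I v. legal_from I (c s) t (insert v S) (b - 1)))"

definition adaptive_policies :: "('v, 's) sbmsm \<Rightarrow> ('v, 's) policy set" where
  "adaptive_policies I = {\<pi>. legal_from I \<pi> 1 {} (budget I)}"

text \<open>
  \<open>selected \<pi> t \<eta> r\<close> is the set of items that \<open>\<pi>\<close>, when started in round \<open>t\<close>, selects in round \<open>r\<close>
  if \<open>\<eta>\<close> is the sequence of realized states.
\<close>

primrec selected ::
  "('v, 's) policy \<Rightarrow> nat \<Rightarrow> (nat \<Rightarrow> 'v \<Rightarrow> 's) \<Rightarrow> nat \<Rightarrow> 'v set" where
  "selected Stop = (\<lambda>t \<eta> r. {})"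
| "selected (Next_Round \<pi>) = (\<lambda>t \<eta> r. selected \<pi> (Suc t) \<eta> r)"
| "selected (Select v c) =
     (\<lambda>t \<eta> r. (if r = t then {v} else {}) \<union> selected (c (\<eta> t v)) t \<eta> r)"

text \<open>
  Everything is non-negative, so values are taken in the extended non-negative reals and need no
  integrability assumption on the rewards.
\<close>

definition policy_value :: "('v, 's) sbmsm \<Rightarrow> ('v, 's) policy \<Rightarrow> ennreal" where
  "policy_value I \<pi> =
     (\<integral>\<^sup>+ \<eta>. (\<Sum>t=1..rounds I. ennreal (reward I t (selected \<pi> 1 \<eta> t) (\<eta> t)))
        \<partial>measure_pmf (joint_dist I))"

text \<open>
  The budget vector is chosen before any observation: the number of items selected in each round
  is the same for all realizations.
\<close>

definition partially_adaptive_policies :: "('v, 's) sbmsm \<Rightarrow> ('v, 's) policy set" where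
  "partially_adaptive_policies I =
     {\<pi> \<in> adaptive_policies I.
        \<exists>b :: nat \<Rightarrow> nat. (\<Sum>t=1..rounds I. b t) \<le> budget I \<and>
          (\<forall>\<eta> \<in> {1..rounds I} \<rightarrow> states I. \<forall>t\<in>{1..rounds I}. card (selected \<pi> 1 \<eta> t) = b t)}"

definition optimal_in ::
  "('v, 's) sbmsm \<Rightarrow> ('v, 's) policy set \<Rightarrow> ('v, 's) policy \<Rightarrow> bool" where
  "optimal_in I C \<pi> \<longleftrightarrow> \<pi> \<in> C \<and> (\<forall>\<pi>'\<in>C. policy_value I \<pi>' \<le> policy_value I \<pi>)"


section \<open>Single-round policies\<close>

datatype ('v, 's) round_policy =
    Done
  | Pick 'v "'s \<Rightarrow> ('v, 's) round_policy"

primrec legal_round ::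
  "('v, 's) sbmsm \<Rightarrow> ('v, 's) round_policy \<Rightarrow> 'v set \<Rightarrow> bool" where
  "legal_round I Done = (\<lambda>S. True)"
| "legal_round I (Pick v c) =
     (\<lambda>S. v \<in> items I - S \<and> (\<forall>s\<in>local_states I v. legal_round I (c s) (insert v S)))"

primrec picked :: "('v, 's) round_policy \<Rightarrow> ('v \<Rightarrow> 's) \<Rightarrow> 'v set" where
  "picked Done = (\<lambda>\<eta>. {})"
| "picked (Pick v c) = (\<lambda>\<eta>. insert v (picked (c (\<eta> v)) \<eta>))"

definition round_opt :: "('v, 's) sbmsm \<Rightarrow> nat \<Rightarrow> nat \<Rightarrow> ennreal" where
  "round_opt I t k =
     (SUP q \<in> {q. legal_round I q {} \<and> (\<forall>\<eta>\<in>states I. card (picked q \<eta>) = k)}.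
        \<integral>\<^sup>+ \<eta>. ennreal (reward I t (picked q \<eta>) \<eta>) \<partial>measure_pmf (state_dist I t))"


section \<open>Standing assumptions\<close>

text \<open>
  A partial state \<open>\<langle>S, \<eta>\<rangle>\<close> is the map with domain \<open>S\<close> sending \<open>v\<close> to \<open>\<eta> v\<close>; the order on partial
  states is \<open>\<subseteq>\<^sub>m\<close>.
\<close>

definition consistent :: "('v \<rightharpoonup> 's) \<Rightarrow> ('v \<Rightarrow> 's) set" where
  "consistent \<psi> = {\<eta>. \<psi> \<subseteq>\<^sub>m (\<lambda>v. Some (\<eta> v))}"

text \<open>
  Only partial states of positive probability in round \<open>t\<close> are considered, since conditional
  expectations are undefined for the others.
\<close>

definition partial_states :: "('v, 's) sbmsm \<Rightarrow> nat \<Rightarrow> ('v \<rightharpoonup> 's) set" where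
  "partial_states I t =
     {\<psi>. dom \<psi> \<subseteq> items I \<and> set_pmf (state_dist I t) \<inter> consistent \<psi> \<noteq> {}}"

definition cond_dist :: "('v, 's) sbmsm \<Rightarrow> nat \<Rightarrow> ('v \<rightharpoonup> 's) \<Rightarrow> ('v \<Rightarrow> 's) pmf" where
  "cond_dist I t \<psi> = cond_pmf (state_dist I t) (consistent \<psi>)"

definition exp_marginal :: "('v, 's) sbmsm \<Rightarrow> nat \<Rightarrow> 'v \<Rightarrow> ('v \<rightharpoonup> 's) \<Rightarrow> real" where
  "exp_marginal I t v \<psi> =
     measure_pmf.expectation (cond_dist I t \<psi>)
       (\<lambda>\<eta>. reward I t (insert v (dom \<psi>)) \<eta> - reward I t (dom \<psi>) \<eta>)"

text \<open>
  Being polynomial is a property of a class of instances: \<open>sz\<close> is the measure of instance size and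
  the polynomial \<open>p\<close> is common to the whole class.
\<close>

definition polynomially_bounded ::
  "(('v, 's) sbmsm \<Rightarrow> nat) \<Rightarrow> real poly \<Rightarrow> ('v, 's) sbmsm \<Rightarrow> bool" where
  "polynomially_bounded sz p I \<longleftrightarrow>
     (\<exists>l L :: real. l > 0 \<and> L > 0 \<and>
        L \<le> poly p (real (sz I)) \<and> 1 / l \<le> poly p (real (sz I)) \<and>
        (\<forall>t\<in>{1..rounds I}. \<forall>S\<subseteq>items I. \<forall>v\<in>items I. \<forall>\<eta>\<in>states I.
           reward I t (insert v S) \<eta> - reward I t S \<eta> \<le> L) \<and>
        (\<exists>t\<in>{1..rounds I}. \<exists>v\<in>items I.
           (\<integral>\<^sup>+ \<eta>. ennreal (reward I t {v} \<eta>) \<partial>measure_pmf (state_dist I t)) \<ge> ennreal l))"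

definition monotone_rewards :: "('v, 's) sbmsm \<Rightarrow> bool" where
  "monotone_rewards I \<longleftrightarrow>
     (\<forall>t\<in>{1..rounds I}. \<forall>S S'. \<forall>\<eta>\<in>states I.
        S \<subseteq> S' \<longrightarrow> S' \<subseteq> items I \<longrightarrow> reward I t S \<eta> \<le> reward I t S' \<eta>)"

definition adaptive_submodular :: "('v, 's) sbmsm \<Rightarrow> bool" where
  "adaptive_submodular I \<longleftrightarrow>
     (\<forall>t\<in>{1..rounds I}. \<forall>\<psi>\<in>partial_states I t. \<forall>\<psi>'\<in>partial_states I t. \<forall>v\<in>items I.
        \<psi> \<subseteq>\<^sub>m \<psi>' \<longrightarrow> exp_marginal I t v \<psi> \<ge> exp_marginal I t v \<psi>')"

text \<open>
  The selection made after observing \<open>\<psi>\<close> is \<open>dom \<psi> \<union> picked q \<eta>\<close>.  A policy selecting \<open>k\<close> items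
  exists only for \<open>k \<le> card (items I)\<close>; larger \<open>k\<close> would not enlarge the set of admissible
  selections.
\<close>

definition strongly_adaptive_submodular :: "('v, 's) sbmsm \<Rightarrow> bool" where
  "strongly_adaptive_submodular I \<longleftrightarrow>
     (\<forall>t\<in>{1..rounds I}. \<forall>k\<in>{1..card (items I)}. \<forall>\<psi>\<in>partial_states I t. \<forall>q.
        legal_round I q (dom \<psi>) \<longrightarrow> (\<forall>\<eta>\<in>states I. card (picked q \<eta>) \<le> k) \<longrightarrow>
        ennreal (measure_pmf.expectation (cond_dist I t \<psi>)
          (\<lambda>\<eta>. reward I t (dom \<psi> \<union> picked q \<eta>) \<eta> - reward I t (dom \<psi>) \<eta>))
        \<le> round_opt I t k)"

definition standing_assumptions ::
  "(('v, 's) sbmsm \<Rightarrow> nat) \<Rightarrow> real poly \<Rightarrow> ('v, 's) sbmsm \<Rightarrow> bool" where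
  "standing_assumptions sz p I \<longleftrightarrow>
     polynomially_bounded sz p I \<and> monotone_rewards I \<and>
     adaptive_submodular I \<and> strongly_adaptive_submodular I"


section \<open>Budget-adaptivity gap\<close>

text \<open>
  The suprema are the values of optimal policies whenever these exist.  In \<open>ennreal\<close>, both
  \<open>0 / 0\<close> and \<open>\<infinity> / \<infinity>\<close> are \<open>0\<close>; under the standing assumptions the former can only arise for
  budget \<open>0\<close>, and the latter only if some empty selection has infinite expected reward.
\<close>

definition budget_adaptivity_gap :: "('v, 's) sbmsm \<Rightarrow> ennreal" where
  "budget_adaptivity_gap I =
     (SUP \<pi>\<in>adaptive_policies I. policy_value I \<pi>) /
     (SUP \<pi>\<in>partially_adaptive_policies I. policy_value I \<pi>)"

definition sbmsm_gap :: "(('v, 's) sbmsm \<Rightarrow> nat) \<Rightarrow> real poly \<Rightarrow> ennreal" where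
  "sbmsm_gap sz p =
     (SUP I \<in> {I. sbmsm_instance I \<and> standing_assumptions sz p I}. budget_adaptivity_gap I)"

end

theory Submission imports Defs begin

text \<open>
  Let \<open>g\<^sub>t k\<close> be the optimal single-round value, \<open>X\<close> the optimal partially adaptive value and
  \<open>c = X / B\<close>.  If \<open>g\<^sub>t (b\<^sub>t + 1) \<le> c (b\<^sub>t + 1)\<close>, then strong adaptive submodularity bounds the
  expected reward of any adaptive selection \<open>S\<^sub>t\<close> in round \<open>t\<close>, even one with adaptive stopping, by
  \<open>g\<^sub>t b\<^sub>t + c E \<bar>S\<^sub>t\<bar>\<close>.  Choosing each \<open>b\<^sub>t\<close> least with this property forces \<open>\<Sum> b\<^sub>t \<le> B\<close>, so
  summing over the rounds bounds every adaptive policy by \<open>\<Sum> g\<^sub>t b\<^sub>t + c B \<le> X + X\<close>.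
\<close>

section \<open>Single-round decision trees\<close>

lemma finite_picked: "finite (picked q \<eta>)"
  by (induction q) auto

lemma picked_subset:
  assumes "legal_round I q S" "\<eta> \<in> states I"
  shows "picked q \<eta> \<subseteq> items I - S"
  using assms
proof (induction q arbitrary: S)
  case (Pick v c)
  have "\<eta> v \<in> local_states I v"
    using Pick.prems by (auto simp: states_def PiE_iff)
  then show ?case
    using Pick.prems Pick.IH[of "c (\<eta> v)" "insert v S"] by auto
qed auto

text \<open>A legal tree never queries an item of \<open>S\<close> again, so its run cannot see the
  state of \<open>v\<close>.\<close>

lemma picked_upd:
  assumes "legal_round I q S" "\<eta> \<in> states I" "v \<in> S"
  shows "picked q (\<eta>(v := s)) = picked q \<eta>"
  using assms
proof (induction q arbitrary: S)
  case (Pick w c)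
  have "\<eta> w \<in> local_states I w" "w \<noteq> v"
    using Pick.prems by (auto simp: states_def PiE_iff)
  then show ?case
    using Pick.prems Pick.IH[of "c (\<eta> w)" "insert w S"] by auto
qed auto

lemma states_upd:
  assumes "\<eta> \<in> states I" "v \<in> items I" "s \<in> local_states I v"
  shows "\<eta>(v := s) \<in> states I"
  using assms by (auto simp: states_def PiE_iff extensional_def)

lemma card_picked_Pick:
  assumes "legal_round I (Pick v c) S" "\<eta> \<in> states I"
  shows "card (picked (Pick v c) \<eta>) = Suc (card (picked (c (\<eta> v)) \<eta>))"
proof -
  have "\<eta> v \<in> local_states I v"
    using assms by (auto simp: states_def PiE_iff)
  then have "picked (c (\<eta> v)) \<eta> \<subseteq> items I - insert v S"
    using assms by (intro picked_subset) auto
  then show ?thesis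
    using finite_picked[of "c (\<eta> v)" \<eta>] by (auto simp: card_insert_if)
qed

text \<open>Setting the state of \<open>v\<close> to \<open>s\<close> forces the branch
  \<open>c s\<close>, whose own run does not see this change. A constant number of picks is thus
  inherited by every subtree, on all of \<open>states I\<close>, not just on states with
  \<open>\<eta> v = s\<close>.\<close>

lemma card_picked_subtree:
  assumes "legal_round I (Pick v c) S" "\<forall>\<eta>\<in>states I. card (picked (Pick v c) \<eta>) = k"
    and "s \<in> local_states I v" "\<eta> \<in> states I"
  shows "Suc (card (picked (c s) \<eta>)) = k"
proof -
  have "\<eta>(v := s) \<in> states I"
    using assms by (intro states_upd) auto
  moreover have "picked (c s) (\<eta>(v := s)) = picked (c s) \<eta>"
    using assms by (intro picked_upd[where S = "insert v S"]) auto
  ultimately show ?thesis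
    using assms(2) card_picked_Pick[OF assms(1), of "\<eta>(v := s)"]
    by (metis fun_upd_same)
qed

section \<open>Truncating and padding trees to a prescribed number of picks\<close>

primrec trunc :: "nat \<Rightarrow> ('v, 's) round_policy \<Rightarrow> ('v, 's) round_policy" where
  "trunc 0 q = Done"
| "trunc (Suc k) q = (case q of Done \<Rightarrow> Done | Pick v c \<Rightarrow> Pick v (\<lambda>s. trunc k (c s)))"

lemma trunc_Done [simp]: "trunc k Done = Done"
  by (cases k) auto

lemma legal_trunc: "legal_round I q S \<Longrightarrow> legal_round I (trunc k q) S"
  by (induction k arbitrary: q S) (auto split: round_policy.splits)

lemma picked_trunc_mono:
  "j \<le> k \<Longrightarrow> picked (trunc j q) \<eta> \<subseteq> picked (trunc k q) \<eta>"
proof (induction j arbitrary: k q)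
  case (Suc j)
  then show ?case
    by (cases k) (fastforce split: round_policy.splits)+
qed auto

lemma card_picked_trunc_le: "card (picked (trunc k q) \<eta>) \<le> k"
proof (induction k arbitrary: q)
  case (Suc k)
  show ?case
  proof (cases q)
    case (Pick v c)
    then show ?thesis
      using Suc.IH[of "c (\<eta> v)"] finite_picked[of "trunc k (c (\<eta> v))" \<eta>]
      by (auto simp: card_insert_if)
  qed auto
qed auto

lemma picked_trunc_eq:
  assumes "legal_round I q S" "\<eta> \<in> states I" "card (picked q \<eta>) \<le> k"
  shows "picked (trunc k q) \<eta> = picked q \<eta>"
  using assms
proof (induction k arbitrary: q S)
  case 0
  then show ?case using finite_picked[of q \<eta>] by auto
next
  case (Suc k)
  show ?case
  proof (cases q)
    case (Pick v c)
    have "\<eta> v \<in> local_states I v"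
      using Suc.prems Pick by (auto simp: states_def PiE_iff)
    then show ?thesis
      using Suc.prems Suc.IH[of "c (\<eta> v)" "insert v S"] card_picked_Pick[of I v c S \<eta>] Pick by simp
  qed auto
qed

text \<open>Follows \<open>q\<close> for at most \<open>k\<close> picks and, if \<open>q\<close>
  stops early, continues with arbitrary items of \<open>V\<close> outside the current
  \<open>S\<close>. The choice by \<open>SOME\<close> is meaningful as long as such an item is
  left.\<close>

primrec pad :: "'v set \<Rightarrow> nat \<Rightarrow> 'v set \<Rightarrow> ('v, 's) round_policy \<Rightarrow> ('v, 's) round_policy" where
  "pad V 0 S q = Done"
| "pad V (Suc k) S q =
    (case q of
      Done \<Rightarrow> let v = SOME v. v \<in> V - S in Pick v (\<lambda>_. pad V k (insert v S) Done)
    | Pick v c \<Rightarrow> Pick v (\<lambda>s. pad V k (insert v S) (c s)))"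

text \<open>The bound on \<open>card S + k\<close> is preserved along every branch and guarantees
  that a fresh item exists whenever another pick is due.\<close>

lemma pad_props:
  assumes "legal_round I q S" "finite (items I)" "S \<subseteq> items I" "card S + k \<le> card (items I)"
  shows "legal_round I (pad (items I) k S q) S \<and>
    (\<forall>\<eta>\<in>states I. card (picked (pad (items I) k S q) \<eta>) = k \<and>
      picked (trunc k q) \<eta> \<subseteq> picked (pad (items I) k S q) \<eta>)"
  using assms
proof (induction k arbitrary: q S)
  case (Suc k)
  have fS: "finite S" using Suc.prems finite_subset by blast
  define p where "p = pad (items I) (Suc k) S q"
  \<comment> \<open>Both shapes of \<open>q\<close> give a node of the same form: after
    \<open>Done\<close> the subtree is constantly \<open>Done\<close>. One induction step then
    serves both.\<close>
  have "\<exists>v c. v \<in> items I - S \<and> p = Pick v (\<lambda>s. pad (items I) k (insert v S) (c s)) \<and>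
      (\<forall>s\<in>local_states I v. legal_round I (c s) (insert v S)) \<and>
      (\<forall>\<eta>. picked (trunc (Suc k) q) \<eta> \<subseteq> insert v (picked (trunc k (c (\<eta> v))) \<eta>))"
    (is "\<exists>v c. ?P v c")
  proof (cases q)
    case Done
    have "S \<noteq> items I" using Suc.prems by auto
    then have "\<exists>v. v \<in> items I - S" using Suc.prems by blast
    then have "(SOME v. v \<in> items I - S) \<in> items I - S" by (rule someI_ex)
    then show ?thesis
      unfolding p_def Done
      by (intro exI[of _ "SOME v. v \<in> items I - S"] exI[of _ "\<lambda>_. Done"]) (auto simp: Let_def)
  next
    case (Pick v c)
    then show ?thesis
      unfolding p_def using Suc.prems by (intro exI[of _ v] exI[of _ c]) auto
  qed
  then obtain v c where vc: "?P v c" by (elim exE)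
  then have v: "v \<in> items I - S"
    and p: "p = Pick v (\<lambda>s. pad (items I) k (insert v S) (c s))"
    and c: "\<And>s. s \<in> local_states I v \<Longrightarrow> legal_round I (c s) (insert v S)"
    and sub: "\<And>\<eta>. picked (trunc (Suc k) q) \<eta> \<subseteq> insert v (picked (trunc k (c (\<eta> v))) \<eta>)"
    by auto
  have IH: "legal_round I (pad (items I) k (insert v S) (c s)) (insert v S) \<and>
    (\<forall>\<eta>\<in>states I. card (picked (pad (items I) k (insert v S) (c s)) \<eta>) = k \<and>
      picked (trunc k (c s)) \<eta> \<subseteq> picked (pad (items I) k (insert v S) (c s)) \<eta>)"
    if "s \<in> local_states I v" for s
    using Suc.prems v fS c[OF that] by (intro Suc.IH) auto
  have legal: "legal_round I p S" using IH v by (auto simp: p)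
  moreover have "card (picked p \<eta>) = Suc k \<and> picked (trunc (Suc k) q) \<eta> \<subseteq> picked p \<eta>"
    if \<eta>: "\<eta> \<in> states I" for \<eta>
  proof -
    have "\<eta> v \<in> local_states I v" using \<eta> v by (auto simp: states_def PiE_iff)
    then show ?thesis
      using IH[of "\<eta> v"] \<eta> sub[of \<eta>] card_picked_Pick[OF legal[unfolded p] \<eta>] p by auto
  qed
  ultimately show ?case unfolding p_def by blast
qed simp

section \<open>Integrals and finite sums\<close>

text \<open>An expectation splits over the values of \<open>h\<close>. The outer integral runs over
  the image of the support only: this set is countable, even if the type of values is not, which
  allows the integrals to be swapped.\<close>

lemma nn_integral_pmf_fibers:
  fixes F :: "'a \<Rightarrow> ennreal"
  shows "(\<integral>\<^sup>+x. F x \<partial>measure_pmf p) =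
    (\<integral>\<^sup>+s. (\<integral>\<^sup>+x. F x * indicator {x. h x = s} x \<partial>measure_pmf p) \<partial>count_space (h ` set_pmf p))"
proof -
  have "(\<integral>\<^sup>+s. F x * indicator {x. h x = s} x \<partial>count_space (h ` set_pmf p)) = F x"
    if "x \<in> set_pmf p" for x
  proof -
    have "(\<integral>\<^sup>+s. F x * indicator {x. h x = s} x \<partial>count_space (h ` set_pmf p)) =
      (\<integral>\<^sup>+s. F x * indicator {h x} s \<partial>count_space (h ` set_pmf p))"
      by (intro nn_integral_cong) (auto split: split_indicator)
    also have "\<dots> = F x * emeasure (count_space (h ` set_pmf p)) {h x}"
      using that by (intro nn_integral_cmult_indicator) auto
    also have "\<dots> = F x" using that by (subst emeasure_count_space) auto
    finally show ?thesis .
  qed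
  then have "(\<integral>\<^sup>+x. F x \<partial>measure_pmf p) =
    (\<integral>\<^sup>+x. (\<integral>\<^sup>+s. F x * indicator {x. h x = s} x \<partial>count_space (h ` set_pmf p)) \<partial>measure_pmf p)"
    by (intro nn_integral_cong_AE) (simp add: AE_measure_pmf_iff)
  also have "\<dots> = (\<integral>\<^sup>+s. (\<integral>\<^sup>+x. F x * indicator {x. h x = s} x \<partial>measure_pmf p) \<partial>count_space (h ` set_pmf p))"
    by (intro nn_integral_count_space_nn_integral) auto
  finally show ?thesis .
qed

text \<open>Redrawing one coordinate independently leaves a product law unchanged. This is how
  independence across rounds enters the bound on adaptive policies.\<close>

lemma nn_integral_Pi_pmf_fix:
  assumes "finite A" "t \<in> A"
  shows "(\<integral>\<^sup>+\<eta>. F \<eta> \<partial>Pi_pmf A d p) = (\<integral>\<^sup>+\<eta>. (\<integral>\<^sup>+x. F (\<eta>(t := x)) \<partial>p t) \<partial>Pi_pmf A d p)"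
proof -
  have A: "A = insert t (A - {t})" using assms by auto
  have 1: "(\<integral>\<^sup>+\<eta>. G \<eta> \<partial>Pi_pmf A d p) = (\<integral>\<^sup>+\<eta>. (\<integral>\<^sup>+x. G (\<eta>(t := x)) \<partial>p t) \<partial>Pi_pmf (A - {t}) d p)" for G
    using assms
    by (subst A, subst Pi_pmf_insert, simp, simp, subst pair_commute_pmf)
       (simp add: nn_integral_pair_pmf' case_prod_unfold)
  \<comment> \<open>Both sides are rewritten by \<open>1\<close>; on the right the first draw of
    coordinate \<open>t\<close> is overwritten by the second and integrates out.\<close>
  show ?thesis by (simp add: 1)
qed

text \<open>The choices at different indices are independent, so the suprema can be taken one index
  at a time; \<open>c\<close> collects the terms already fixed. Nonempty index sets allow a constant
  to move inside a supremum.\<close>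

lemma sum_SUP_le:
  fixes F :: "'a \<Rightarrow> 'b \<Rightarrow> ennreal"
  assumes "finite A" "\<And>t. t \<in> A \<Longrightarrow> Q t \<noteq> {}"
    and "\<And>q. (\<And>t. t \<in> A \<Longrightarrow> q t \<in> Q t) \<Longrightarrow> c + (\<Sum>t\<in>A. F t (q t)) \<le> X"
  shows "c + (\<Sum>t\<in>A. SUP q\<in>Q t. F t q) \<le> X"
  using assms
proof (induction A arbitrary: c)
  case (insert a A)
  have "(F a x + c) + (\<Sum>t\<in>A. SUP q\<in>Q t. F t q) \<le> X" if x: "x \<in> Q a" for x
  proof (rule insert.IH)
    fix q assume q: "\<And>t. t \<in> A \<Longrightarrow> q t \<in> Q t"
    have "c + (\<Sum>t\<in>insert a A. F t ((q(a := x)) t)) \<le> X"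
      using q x by (intro insert.prems) auto
    moreover have "(\<Sum>t\<in>A. F t ((q(a := x)) t)) = (\<Sum>t\<in>A. F t (q t))"
      using insert.hyps by (intro sum.cong) auto
    ultimately show "(F a x + c) + (\<Sum>t\<in>A. F t (q t)) \<le> X"
      using insert.hyps by (simp add: ac_simps)
  qed (use insert.prems in auto)
  then have "(SUP x\<in>Q a. F a x + (c + (\<Sum>t\<in>A. SUP q\<in>Q t. F t q))) \<le> X"
    by (intro SUP_least) (simp add: ac_simps)
  then have "(SUP x\<in>Q a. F a x) + (c + (\<Sum>t\<in>A. SUP q\<in>Q t. F t q)) \<le> X"
    using insert.prems(1)[of a] by (simp add: ennreal_SUP_add_left)
  then show ?case using insert.hyps by (simp add: ac_simps)
next
  case empty
  then show ?case by simp
qed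

text \<open>Greedy choice: each entry takes as much of the remaining total as \<open>c\<close>
  permits.\<close>

lemma bounded_subsum:
  fixes c :: "'a \<Rightarrow> nat"
  assumes "finite A" "B \<le> sum c A"
  obtains b where "\<And>t. b t \<le> c t" "sum b A = B"
proof -
  have "\<exists>b. (\<forall>t. b t \<le> c t) \<and> sum b A = B"
    using assms
  proof (induction A arbitrary: B)
    case empty
    then show ?case by (intro exI[of _ "\<lambda>_. 0"]) auto
  next
    case (insert a A)
    have "B - min B (c a) \<le> sum c A" using insert by auto
    then obtain b where b: "\<forall>t. b t \<le> c t" "sum b A = B - min B (c a)"
      using insert.IH by blast
    have "sum (b(a := min B (c a))) A = sum b A"
      using insert.hyps by (intro sum.cong) auto
    then show ?case
      using b insert.hyps by (intro exI[of _ "b(a := min B (c a))"]) auto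
  qed
  then show ?thesis using that by auto
qed

text \<open>The nonzero terms belong to positive multiples of \<open>k\<close> up to
  \<open>m\<close>. There are at most \<open>m div k\<close> of them, and each contributes
  \<open>k\<close>.\<close>

lemma sum_threshold_le: "(\<Sum>i<N. k * (if (i + 1) * k \<le> m then 1 else 0)) \<le> (m :: nat)"
proof (cases "k = 0")
  case False
  have "(\<Sum>i<N. k * (if (i + 1) * k \<le> m then 1 else 0)) = k * card {i\<in>{..<N}. (i + 1) * k \<le> m}"
    by (simp add: sum.If_cases sum_distrib_left[symmetric] Int_def)
  also have "card {i\<in>{..<N}. (i + 1) * k \<le> m} \<le> card {..<m div k}"
    using False by (intro card_mono) (auto simp: less_eq_div_iff_mult_less_eq Suc_le_eq[symmetric])
  then have "k * card {i\<in>{..<N}. (i + 1) * k \<le> m} \<le> k * (m div k)" by simp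
  also have "\<dots> \<le> m" by simp
  finally show ?thesis .
qed simp

section \<open>One round against a price per item\<close>

text \<open>The uniform bound on increments serves integrability: it lets the real expectation in
  strong adaptive submodularity be read as a nonnegative integral.\<close>

locale sbmsm_setting =
  fixes I :: "('v, 's) sbmsm"
  assumes inst: "sbmsm_instance I"
    and mono: "monotone_rewards I"
    and strong: "strongly_adaptive_submodular I"
    and bounded_increments: "\<exists>L. \<forall>t\<in>{1..rounds I}. \<forall>S\<subseteq>items I. \<forall>v\<in>items I. \<forall>\<eta>\<in>states I.
      reward I t (insert v S) \<eta> - reward I t S \<eta> \<le> L"
begin

abbreviation rounds_set :: "nat set" where "rounds_set \<equiv> {1..rounds I}"

lemma finite_items: "finite (items I)"
  using inst by (simp add: sbmsm_instance_def)

lemma state_dist_states: "t \<in> rounds_set \<Longrightarrow> \<eta> \<in> set_pmf (state_dist I t) \<Longrightarrow> \<eta> \<in> states I"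
  using inst by (auto simp: sbmsm_instance_def)

lemma states_nonempty: "states I \<noteq> {}"
proof -
  have "1 \<in> rounds_set" using inst by (simp add: sbmsm_instance_def)
  then show ?thesis
    using state_dist_states[of 1] set_pmf_not_empty[of "state_dist I 1"] by blast
qed

lemma reward_nonneg: "t \<in> rounds_set \<Longrightarrow> S \<subseteq> items I \<Longrightarrow> \<eta> \<in> states I \<Longrightarrow> 0 \<le> reward I t S \<eta>"
  using inst by (auto simp: sbmsm_instance_def)

lemma reward_mono:
  "t \<in> rounds_set \<Longrightarrow> S \<subseteq> S' \<Longrightarrow> S' \<subseteq> items I \<Longrightarrow> \<eta> \<in> states I \<Longrightarrow> reward I t S \<eta> \<le> reward I t S' \<eta>"
  using mono by (auto simp: monotone_rewards_def)

text \<open>The items of \<open>S' - S\<close> are added one at a time, each for at most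
  \<open>\<bar>L\<bar>\<close>. The absolute value makes the bound monotone in the number of
  items.\<close>

lemma gain_bounded:
  obtains C where "\<And>t S S' \<eta>. t \<in> rounds_set \<Longrightarrow> S \<subseteq> S' \<Longrightarrow> S' \<subseteq> items I \<Longrightarrow> \<eta> \<in> states I \<Longrightarrow>
    reward I t S' \<eta> - reward I t S \<eta> \<le> C"
proof -
  obtain L where "\<forall>t\<in>rounds_set. \<forall>S\<subseteq>items I. \<forall>v\<in>items I. \<forall>\<eta>\<in>states I.
      reward I t (insert v S) \<eta> - reward I t S \<eta> \<le> L"
    using bounded_increments by (elim exE)
  then have L: "\<And>t S v \<eta>. t \<in> rounds_set \<Longrightarrow> S \<subseteq> items I \<Longrightarrow> v \<in> items I \<Longrightarrow> \<eta> \<in> states I \<Longrightarrow>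
      reward I t (insert v S) \<eta> - reward I t S \<eta> \<le> L"
    by blast
  have "reward I t S' \<eta> - reward I t S \<eta> \<le> real (card (items I)) * \<bar>L\<bar>"
    if h: "t \<in> rounds_set" "S \<subseteq> S'" "S' \<subseteq> items I" "\<eta> \<in> states I" for t S S' \<eta>
  proof -
    have "reward I t (S \<union> D) \<eta> - reward I t S \<eta> \<le> real (card D) * \<bar>L\<bar>"
      if "finite D" "D \<subseteq> items I" for D
      using that
    proof (induction D)
      case (insert v D)
      then show ?case
        using L[of t "S \<union> D" v \<eta>] h order_trans[OF h(2,3)]
        by (auto simp: algebra_simps abs_if)
    qed simp
    from this[of "S' - S"] h have "reward I t S' \<eta> - reward I t S \<eta> \<le> real (card (S' - S)) * \<bar>L\<bar>"
      using finite_subset[OF h(3) finite_items] by (auto simp: Un_absorb1)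
    also have "\<dots> \<le> real (card (items I)) * \<bar>L\<bar>"
      using h finite_items by (intro mult_right_mono) (auto intro!: card_mono)
    finally show ?thesis .
  qed
  then show ?thesis by (rule that)
qed

text \<open>Strong adaptive submodularity multiplied by the probability of the partial state. In
  this unnormalised form it also covers null partial states and can be summed over the branches of a
  tree.\<close>

lemma block_gain_start:
  assumes t: "t \<in> rounds_set" and k: "k \<in> {1..card (items I)}"
    and \<psi>: "dom \<psi> \<subseteq> items I" and q: "legal_round I q (dom \<psi>)"
    and card: "\<And>\<eta>. \<eta> \<in> states I \<Longrightarrow> card (picked q \<eta>) \<le> k"
  shows "(\<integral>\<^sup>+\<eta>. ennreal (reward I t (dom \<psi> \<union> picked q \<eta>) \<eta> - reward I t (dom \<psi>) \<eta>)
      * indicator (consistent \<psi>) \<eta> \<partial>state_dist I t)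
    \<le> round_opt I t k * (\<integral>\<^sup>+\<eta>. indicator (consistent \<psi>) \<eta> \<partial>state_dist I t)"
proof (cases "set_pmf (state_dist I t) \<inter> consistent \<psi> = {}")
  case True
  have "(\<integral>\<^sup>+\<eta>. ennreal (reward I t (dom \<psi> \<union> picked q \<eta>) \<eta> - reward I t (dom \<psi>) \<eta>)
      * indicator (consistent \<psi>) \<eta> \<partial>state_dist I t) = (\<integral>\<^sup>+\<eta>. 0 \<partial>state_dist I t)"
    using True by (intro nn_integral_cong_AE) (auto simp: AE_measure_pmf_iff split: split_indicator)
  then show ?thesis by simp
next
  case False
  let ?P = "state_dist I t" and ?A = "consistent \<psi>"
  let ?f = "\<lambda>\<eta>. reward I t (dom \<psi> \<union> picked q \<eta>) \<eta> - reward I t (dom \<psi>) \<eta>"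
  have em: "emeasure ?P ?A \<noteq> 0" "emeasure ?P ?A \<noteq> \<top>"
    using emeasure_measure_pmf_not_zero[OF False] by auto
  obtain C where C: "\<And>t S S' \<eta>. t \<in> rounds_set \<Longrightarrow> S \<subseteq> S' \<Longrightarrow> S' \<subseteq> items I \<Longrightarrow> \<eta> \<in> states I \<Longrightarrow>
    reward I t S' \<eta> - reward I t S \<eta> \<le> C" by (rule gain_bounded) blast
  have cond: "0 \<le> ?f \<eta> \<and> ?f \<eta> \<le> C" if "\<eta> \<in> set_pmf (cond_dist I t \<psi>)" for \<eta>
  proof -
    have "\<eta> \<in> states I"
      using that False state_dist_states[OF t] by (auto simp: cond_dist_def)
    moreover have "dom \<psi> \<union> picked q \<eta> \<subseteq> items I"
      using \<psi> picked_subset[OF q \<open>\<eta> \<in> states I\<close>] by auto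
    ultimately show ?thesis
      using C[of t "dom \<psi>" "dom \<psi> \<union> picked q \<eta>" \<eta>] reward_mono[of t "dom \<psi>" "dom \<psi> \<union> picked q \<eta>" \<eta>] t
      by auto
  qed
  have "(\<integral>\<^sup>+\<eta>. ennreal (?f \<eta>) * indicator ?A \<eta> \<partial>?P) / emeasure ?P ?A
      = (\<integral>\<^sup>+\<eta>. ennreal (?f \<eta>) \<partial>cond_dist I t \<psi>)"
    unfolding cond_dist_def cond_pmf.rep_eq[OF False]
    by (subst nn_integral_uniform_measure) auto
  \<comment> \<open>A real expectation without integrability would be \<open>0\<close> by
    convention; the bound \<open>C\<close> excludes this.\<close>
  also have "\<dots> = ennreal (measure_pmf.expectation (cond_dist I t \<psi>) ?f)"
    using cond
    by (intro nn_integral_eq_integral measure_pmf.integrable_const_bound[where B = C])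
       (auto simp: AE_measure_pmf_iff)
  also have "\<dots> \<le> round_opt I t k"
  proof -
    have "\<psi> \<in> partial_states I t" using \<psi> False by (auto simp: partial_states_def)
    then show ?thesis
      using strong t k q card by (auto simp: strongly_adaptive_submodular_def)
  qed
  finally have "(\<integral>\<^sup>+\<eta>. ennreal (?f \<eta>) * indicator ?A \<eta> \<partial>?P) / emeasure ?P ?A * emeasure ?P ?A
      \<le> round_opt I t k * emeasure ?P ?A"
    by (rule mult_right_mono) simp
  moreover have "(\<integral>\<^sup>+\<eta>. ennreal (?f \<eta>) * indicator ?A \<eta> \<partial>?P) / emeasure ?P ?A * emeasure ?P ?A
     = (\<integral>\<^sup>+\<eta>. ennreal (?f \<eta>) * indicator ?A \<eta> \<partial>?P)"
  proof -
    have "emeasure ?P ?A / emeasure ?P ?A = 1"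
      using em by (intro ennreal_divide_self) (simp_all only: top.not_eq_extremum not_False_eq_True)
    then show ?thesis by (simp only: ennreal_divide_times mult_1_right)
  qed
  ultimately show ?thesis by simp
qed

lemma consistent_upd:
  "v \<notin> dom \<psi> \<Longrightarrow> consistent (\<psi>(v \<mapsto> s)) = consistent \<psi> \<inter> {\<eta>. \<eta> v = s}"
  unfolding consistent_def map_le_def by (auto simp: dom_def split: if_splits)

text \<open>Induction on the number \<open>m\<close> of picks before the block: observing the root
  item extends \<open>\<psi>\<close> and leaves one pick fewer before the block. The block is
  charged only on states where its first pick, number \<open>m + 1\<close>, is made.\<close>

lemma block_gain_from:
  assumes t: "t \<in> rounds_set" and k: "k \<in> {1..card (items I)}"
    and "dom \<psi> \<subseteq> items I" "legal_round I q (dom \<psi>)"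
  shows "(\<integral>\<^sup>+\<eta>. ennreal (reward I t (dom \<psi> \<union> picked (trunc (m + k) q) \<eta>) \<eta>
        - reward I t (dom \<psi> \<union> picked (trunc m q) \<eta>) \<eta>)
      * indicator (consistent \<psi>) \<eta> \<partial>state_dist I t)
    \<le> round_opt I t k *
      (\<integral>\<^sup>+\<eta>. indicator {\<eta>. m < card (picked q \<eta>)} \<eta> * indicator (consistent \<psi>) \<eta> \<partial>state_dist I t)"
  using assms(3,4)
proof (induction m arbitrary: q \<psi>)
  case 0
  show ?case
  proof (cases q)
    case (Pick v c)
    have "{\<eta>. 0 < card (picked q \<eta>)} = UNIV"
      using finite_picked Pick by (auto simp: card_gt_0_iff)
    moreover have "legal_round I (trunc k q) (dom \<psi>)" using 0 by (intro legal_trunc)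
    ultimately show ?thesis
      using block_gain_start[OF t k 0(1), of "trunc k q"] card_picked_trunc_le[of k q] by simp
  qed simp
next
  case (Suc m)
  show ?case
  proof (cases q)
    case (Pick v c)
    let ?P = "state_dist I t"
    let ?F = "\<lambda>\<psi> q m \<eta>. ennreal (reward I t (dom \<psi> \<union> picked (trunc (m + k) q) \<eta>) \<eta>
        - reward I t (dom \<psi> \<union> picked (trunc m q) \<eta>) \<eta>) * indicator (consistent \<psi>) \<eta>"
    let ?G = "\<lambda>\<psi> q m \<eta>. indicator {\<eta>. m < card (picked q \<eta>)} \<eta> * indicator (consistent \<psi>) \<eta> :: ennreal"
    let ?M = "count_space ((\<lambda>\<eta>. \<eta> v) ` set_pmf ?P)"
    have v: "v \<in> items I" "v \<notin> dom \<psi>" and legal: "legal_round I (Pick v c) (dom \<psi>)"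
      using Suc.prems Pick by auto
    \<comment> \<open>On the fiber \<open>\<eta> v = s\<close> the tree continues as
      \<open>c s\<close>, and \<open>v\<close> moves from the picked items into the domain of the
      partial state.\<close>
    have F: "?F \<psi> q (Suc m) \<eta> * indicator {\<eta>. \<eta> v = s} \<eta> = ?F (\<psi>(v \<mapsto> s)) (c s) m \<eta>" for s \<eta>
      using v by (auto simp: Pick consistent_upd split: split_indicator)
    \<comment> \<open>The number of picks drops by exactly one only on legal states, hence the
      restriction to the support.\<close>
    have G: "?G \<psi> q (Suc m) \<eta> * indicator {\<eta>. \<eta> v = s} \<eta> = ?G (\<psi>(v \<mapsto> s)) (c s) m \<eta>"
      if "\<eta> \<in> set_pmf ?P" for s \<eta>
      using v card_picked_Pick[OF legal state_dist_states[OF t that]]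
      by (auto simp: Pick consistent_upd simp del: picked.simps split: split_indicator)
    have "(\<integral>\<^sup>+\<eta>. ?F \<psi> q (Suc m) \<eta> \<partial>?P) = (\<integral>\<^sup>+s. (\<integral>\<^sup>+\<eta>. ?F (\<psi>(v \<mapsto> s)) (c s) m \<eta> \<partial>?P) \<partial>?M)"
      unfolding F[symmetric] by (rule nn_integral_pmf_fibers)
    also have "\<dots> \<le> (\<integral>\<^sup>+s. round_opt I t k * (\<integral>\<^sup>+\<eta>. ?G (\<psi>(v \<mapsto> s)) (c s) m \<eta> \<partial>?P) \<partial>?M)"
    proof (rule nn_integral_mono)
      fix s assume "s \<in> space ?M"
      then obtain \<eta> where "\<eta> \<in> states I" "s = \<eta> v" using state_dist_states[OF t] by auto
      then have "s \<in> local_states I v" using v by (auto simp: states_def PiE_iff)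
      then show "(\<integral>\<^sup>+\<eta>. ?F (\<psi>(v \<mapsto> s)) (c s) m \<eta> \<partial>?P) \<le> round_opt I t k * (\<integral>\<^sup>+\<eta>. ?G (\<psi>(v \<mapsto> s)) (c s) m \<eta> \<partial>?P)"
        using v legal Suc.prems(1) by (intro Suc.IH) (simp_all only: dom_fun_upd, auto)
    qed
    also have "\<dots> = round_opt I t k * (\<integral>\<^sup>+s. (\<integral>\<^sup>+\<eta>. ?G (\<psi>(v \<mapsto> s)) (c s) m \<eta> \<partial>?P) \<partial>?M)"
      by (rule nn_integral_cmult) simp
    also have "(\<integral>\<^sup>+s. (\<integral>\<^sup>+\<eta>. ?G (\<psi>(v \<mapsto> s)) (c s) m \<eta> \<partial>?P) \<partial>?M)
        = (\<integral>\<^sup>+s. (\<integral>\<^sup>+\<eta>. ?G \<psi> q (Suc m) \<eta> * indicator {\<eta>. \<eta> v = s} \<eta> \<partial>?P) \<partial>?M)"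
      by (intro nn_integral_cong nn_integral_cong_AE) (simp add: AE_measure_pmf_iff G)
    also have "\<dots> = (\<integral>\<^sup>+\<eta>. ?G \<psi> q (Suc m) \<eta> \<partial>?P)"
      by (rule nn_integral_pmf_fibers[symmetric])
    finally show ?thesis .
  qed simp
qed

text \<open>The case of the empty partial state, with gains turned back into values. Monotonicity
  makes the real differences nonnegative, so their embedding into \<open>ennreal\<close> loses
  nothing.\<close>

lemma block_gain:
  assumes "t \<in> rounds_set" "k \<in> {1..card (items I)}" "legal_round I q {}"
  shows "(\<integral>\<^sup>+\<eta>. ennreal (reward I t (picked (trunc (m + k) q) \<eta>) \<eta>) \<partial>state_dist I t)
    \<le> (\<integral>\<^sup>+\<eta>. ennreal (reward I t (picked (trunc m q) \<eta>) \<eta>) \<partial>state_dist I t)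
      + round_opt I t k * (\<integral>\<^sup>+\<eta>. indicator {\<eta>. m < card (picked q \<eta>)} \<eta> \<partial>state_dist I t)"
proof -
  let ?P = "state_dist I t" and ?r = "\<lambda>m \<eta>. reward I t (picked (trunc m q) \<eta>) \<eta>"
  have "(\<integral>\<^sup>+\<eta>. ennreal (?r (m + k) \<eta>) \<partial>?P)
    = (\<integral>\<^sup>+\<eta>. ennreal (?r m \<eta>) + ennreal (?r (m + k) \<eta> - ?r m \<eta>) \<partial>?P)"
  proof (intro nn_integral_cong_AE, simp add: AE_measure_pmf_iff, intro ballI)
    fix \<eta> assume "\<eta> \<in> set_pmf ?P"
    then have \<eta>: "\<eta> \<in> states I" using assms by (intro state_dist_states)
    have sub: "picked (trunc j q) \<eta> \<subseteq> items I" for j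
      using picked_subset[OF legal_trunc[OF assms(3)] \<eta>] by auto
    have "0 \<le> ?r m \<eta>" "?r m \<eta> \<le> ?r (m + k) \<eta>"
      using assms \<eta> sub by (auto intro!: reward_nonneg reward_mono picked_trunc_mono)
    then show "ennreal (?r (m + k) \<eta>) = ennreal (?r m \<eta>) + ennreal (?r (m + k) \<eta> - ?r m \<eta>)"
      by (subst ennreal_plus[symmetric]) auto
  qed
  also have "\<dots> = (\<integral>\<^sup>+\<eta>. ennreal (?r m \<eta>) \<partial>?P) + (\<integral>\<^sup>+\<eta>. ennreal (?r (m + k) \<eta> - ?r m \<eta>) \<partial>?P)"
    by (rule nn_integral_add) auto
  also have "(\<integral>\<^sup>+\<eta>. ennreal (?r (m + k) \<eta> - ?r m \<eta>) \<partial>?P)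
      \<le> round_opt I t k * (\<integral>\<^sup>+\<eta>. indicator {\<eta>. m < card (picked q \<eta>)} \<eta> \<partial>?P)"
  proof -
    have "consistent (Map.empty :: 'v \<rightharpoonup> 's) = UNIV" by (auto simp: consistent_def)
    then show ?thesis using block_gain_from[OF assms(1,2), of Map.empty q m] assms(3) by simp
  qed
  finally show ?thesis by (simp add: add_left_mono)
qed

lemma round_opt_upper:
  assumes "legal_round I q {}" "\<And>\<eta>. \<eta> \<in> states I \<Longrightarrow> card (picked q \<eta>) = k"
  shows "(\<integral>\<^sup>+\<eta>. ennreal (reward I t (picked q \<eta>) \<eta>) \<partial>state_dist I t) \<le> round_opt I t k"
proof -
  have "q \<in> {q. legal_round I q {} \<and> (\<forall>\<eta>\<in>states I. card (picked q \<eta>) = k)}"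
    using assms by blast
  then show ?thesis unfolding round_opt_def by (rule SUP_upper)
qed

text \<open>\<open>round_opt\<close> requires exactly \<open>b\<close> picks and truncation gives at
  most \<open>b\<close>. Padding closes the gap, and by monotonicity it does not lower the
  reward.\<close>

lemma trunc_le_round_opt:
  assumes "t \<in> rounds_set" "b \<le> card (items I)" "legal_round I q {}"
  shows "(\<integral>\<^sup>+\<eta>. ennreal (reward I t (picked (trunc b q) \<eta>) \<eta>) \<partial>state_dist I t) \<le> round_opt I t b"
proof -
  let ?q = "pad (items I) b {} q"
  have q: "legal_round I ?q {}" "\<And>\<eta>. \<eta> \<in> states I \<Longrightarrow> card (picked ?q \<eta>) = b"
    "\<And>\<eta>. \<eta> \<in> states I \<Longrightarrow> picked (trunc b q) \<eta> \<subseteq> picked ?q \<eta>"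
    using pad_props[of I q "{}" b] assms finite_items by auto
  have "(\<integral>\<^sup>+\<eta>. ennreal (reward I t (picked (trunc b q) \<eta>) \<eta>) \<partial>state_dist I t)
    \<le> (\<integral>\<^sup>+\<eta>. ennreal (reward I t (picked ?q \<eta>) \<eta>) \<partial>state_dist I t)"
  proof (intro nn_integral_mono_AE, simp add: AE_measure_pmf_iff, intro ballI ennreal_leI)
    fix \<eta> assume "\<eta> \<in> set_pmf (state_dist I t)"
    then have \<eta>: "\<eta> \<in> states I" using assms by (intro state_dist_states)
    show "reward I t (picked (trunc b q) \<eta>) \<eta> \<le> reward I t (picked ?q \<eta>) \<eta>"
      using assms \<eta> q picked_subset[OF q(1) \<eta>] by (intro reward_mono) auto
  qed
  also have "\<dots> \<le> round_opt I t b" using q by (intro round_opt_upper)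
  finally show ?thesis .
qed

text \<open>
  The first \<open>b\<close> picks are worth at most \<open>round_opt I t b\<close>.  After them the picks are cut into blocks
  of length \<open>b + 1\<close>.  Once its first pick is made, a block is worth at most
  \<open>round_opt I t (b + 1) \<le> (b + 1) * c\<close>, and this is paid for at price \<open>c\<close> by the \<open>b + 1\<close> picks
  ending with that first pick: they have all been made, even if the block is abandoned later.
\<close>

lemma round_value_le:
  assumes t: "t \<in> rounds_set" and b: "b \<le> card (items I)" and q: "legal_round I q {}"
    and c: "b = card (items I) \<or> round_opt I t (b + 1) \<le> c * of_nat (b + 1)"
  shows "(\<integral>\<^sup>+\<eta>. ennreal (reward I t (picked q \<eta>) \<eta>) \<partial>state_dist I t)
    \<le> round_opt I t b + c * (\<integral>\<^sup>+\<eta>. of_nat (card (picked q \<eta>)) \<partial>state_dist I t)"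
proof -
  let ?P = "state_dist I t"
  let ?n = "card (items I)"
  let ?V = "\<lambda>m. (\<integral>\<^sup>+\<eta>. ennreal (reward I t (picked (trunc m q) \<eta>) \<eta>) \<partial>?P)"
  have all: "(\<integral>\<^sup>+\<eta>. ennreal (reward I t (picked q \<eta>) \<eta>) \<partial>?P) = ?V m" if "?n \<le> m" for m
  proof (intro nn_integral_cong_AE, simp add: AE_measure_pmf_iff, intro ballI)
    fix \<eta> assume "\<eta> \<in> set_pmf ?P"
    then have \<eta>: "\<eta> \<in> states I" using t by (intro state_dist_states)
    have "card (picked q \<eta>) \<le> m"
      using picked_subset[OF q \<eta>] finite_items that card_mono[of "items I" "picked q \<eta>"] by auto
    then show "ennreal (reward I t (picked q \<eta>) \<eta>) = ennreal (reward I t (picked (trunc m q) \<eta>) \<eta>)"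
      by (subst picked_trunc_eq[OF q \<eta>]) auto
  qed
  show ?thesis
  \<comment> \<open>If \<open>b = ?n\<close>, the first \<open>b\<close> picks are all picks;
    otherwise \<open>b + 1\<close> is an admissible block length.\<close>
  proof (cases "b = ?n")
    case True
    then show ?thesis
      using all[of b] trunc_le_round_opt[OF t b q] by (auto intro: order_trans add_increasing2)
  next
    case False
    then have k: "b + 1 \<in> {1..?n}" and c: "round_opt I t (b + 1) \<le> c * of_nat (b + 1)"
      using b c by auto
    \<comment> \<open>Block \<open>i\<close> starts with pick number
      \<open>b + i * (b + 1) + 1 = (i + 1) * (b + 1)\<close>, so \<open>?p i\<close> is the
      probability of reaching the threshold of \<open>sum_threshold_le\<close> with
      \<open>k = b + 1\<close>.\<close>
    let ?p = "\<lambda>i. (\<integral>\<^sup>+\<eta>. indicator {\<eta>. b + i * (b + 1) < card (picked q \<eta>)} \<eta> \<partial>?P)"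
    have blocks: "?V (b + N * (b + 1)) \<le> round_opt I t b + (\<Sum>i<N. c * of_nat (b + 1) * ?p i)" for N
    proof (induction N)
      case 0
      then show ?case using trunc_le_round_opt[OF t b q] by simp
    next
      case (Suc N)
      have "?V (b + Suc N * (b + 1)) = ?V (b + N * (b + 1) + (b + 1))" by (simp add: algebra_simps)
      also have "\<dots> \<le> ?V (b + N * (b + 1)) + round_opt I t (b + 1) * ?p N"
        by (rule block_gain[OF t k q])
      also have "\<dots> \<le> (round_opt I t b + (\<Sum>i<N. c * of_nat (b + 1) * ?p i)) + c * of_nat (b + 1) * ?p N"
        by (intro add_mono Suc.IH mult_right_mono c) auto
      finally show ?case by (simp add: add.assoc)
    qed
    have "(\<Sum>i<?n. of_nat (b + 1) * ?p i)
      = (\<integral>\<^sup>+\<eta>. (\<Sum>i<?n. of_nat (b + 1) * indicator {\<eta>. b + i * (b + 1) < card (picked q \<eta>)} \<eta>) \<partial>?P)"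
      by (subst nn_integral_sum) (auto simp: nn_integral_cmult)
    also have "\<dots> \<le> (\<integral>\<^sup>+\<eta>. of_nat (card (picked q \<eta>)) \<partial>?P)"
    proof (intro nn_integral_mono)
      fix \<eta>
      have "(\<Sum>i<?n. of_nat (b + 1) * indicator {\<eta>. b + i * (b + 1) < card (picked q \<eta>)} \<eta>)
        = (of_nat (\<Sum>i<?n. (b + 1) * (if (i + 1) * (b + 1) \<le> card (picked q \<eta>) then 1 else 0)) :: ennreal)"
        unfolding of_nat_sum by (intro sum.cong) (auto simp: indicator_def)
      also have "\<dots> \<le> of_nat (card (picked q \<eta>))"
        by (intro of_nat_mono sum_threshold_le)
      finally show "(\<Sum>i<?n. of_nat (b + 1) * indicator {\<eta>. b + i * (b + 1) < card (picked q \<eta>)} \<eta>)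
        \<le> (of_nat (card (picked q \<eta>)) :: ennreal)" .
    qed
    finally have cost: "(\<Sum>i<?n. of_nat (b + 1) * ?p i) \<le> (\<integral>\<^sup>+\<eta>. of_nat (card (picked q \<eta>)) \<partial>?P)" .
    have "(\<integral>\<^sup>+\<eta>. ennreal (reward I t (picked q \<eta>) \<eta>) \<partial>?P) = ?V (b + ?n * (b + 1))"
      \<comment> \<open>Blocks have length at least one, so \<open>?n\<close> of them reach past
        every possible pick.\<close>
      by (rule all) simp
    also have "\<dots> \<le> round_opt I t b + (\<Sum>i<?n. c * of_nat (b + 1) * ?p i)" by (rule blocks)
    also have "(\<Sum>i<?n. c * of_nat (b + 1) * ?p i) = c * (\<Sum>i<?n. of_nat (b + 1) * ?p i)"
      by (simp add: sum_distrib_left mult.assoc)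
    also have "\<dots> \<le> c * (\<integral>\<^sup>+\<eta>. of_nat (card (picked q \<eta>)) \<partial>?P)"
      using cost by (rule mult_left_mono) simp
    finally show ?thesis by (simp add: add_left_mono)
  qed
qed

end

section \<open>Multi-round policies\<close>

primrec run_round ::
  "('v, 's) round_policy \<Rightarrow> ('v, 's) policy \<Rightarrow> ('v, 's) policy" where
  "run_round Done K = K"
| "run_round (Pick v c) K = Select v (\<lambda>s. run_round (c s) K)"

primrec current_round :: "('v, 's) policy \<Rightarrow> ('v, 's) round_policy" where
  "current_round Stop = Done"
| "current_round (Next_Round \<pi>) = Done"
| "current_round (Select v c) = Pick v (\<lambda>s. current_round (c s))"

text \<open>Plays \<open>q t\<close> for \<open>m\<close> successive rounds with budget
  \<open>B\<close> left. The test \<open>B = b t\<close> is forced by the model: once the budget is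
  spent, only \<open>Stop\<close> is legal.\<close>

primrec chain :: "(nat \<Rightarrow> ('v, 's) round_policy) \<Rightarrow> (nat \<Rightarrow> nat) \<Rightarrow> nat \<Rightarrow> nat \<Rightarrow> nat \<Rightarrow> ('v, 's) policy" where
  "chain q b 0 t B = Stop"
| "chain q b (Suc m) t B = run_round (q t)
    (if B = b t then Stop else Next_Round (chain q b m (Suc t) (B - b t)))"

lemma selected_before: "r < t \<Longrightarrow> selected \<pi> t \<eta> r = {}"
  by (induction \<pi> arbitrary: t) auto

lemma finite_selected: "finite (selected \<pi> t \<eta> r)"
  by (induction \<pi> arbitrary: t) auto

lemma selected_run_round:
  "selected (run_round q K) t \<eta> r = (if r = t then picked q (\<eta> t) else {}) \<union> selected K t \<eta> r"
  by (induction q) auto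

lemma selected_current_round: "selected \<pi> t \<eta> t = picked (current_round \<pi>) (\<eta> t)"
  by (induction \<pi>) (auto simp: selected_before)

lemma legal_current_round: "legal_from I \<pi> t S b \<Longrightarrow> legal_round I (current_round \<pi>) S"
  by (induction \<pi> arbitrary: t S b) auto

text \<open>Once the states of the other rounds are fixed, the observations before round
  \<open>t\<close> determine where the policy enters that round. What it plays there is a
  single-round tree, namely \<open>Done\<close> if it stops earlier.\<close>

lemma selected_depends_on_round:
  assumes "legal_from I \<pi> r S b" "r < t" "\<forall>i\<in>{1..rounds I} - {t}. \<eta> i \<in> states I" "r \<ge> 1"
  shows "\<exists>q. legal_round I q {} \<and> (\<forall>x. selected \<pi> r (\<eta>(t := x)) t = picked q x)"
  using assms
proof (induction \<pi> arbitrary: r S b)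
  case Stop
  show ?case by (intro exI[of _ Done]) auto
next
  case (Next_Round \<pi>)
  show ?case
  proof (cases "Suc r = t")
    case True
    then have "legal_round I (current_round \<pi>) {}"
      using Next_Round.prems by (intro legal_current_round) auto
    then show ?thesis
      using selected_current_round[of \<pi> t] True by (intro exI[of _ "current_round \<pi>"]) auto
  next
    case False
    then show ?thesis using Next_Round.prems Next_Round.IH[of "Suc r" "{}" b] by auto
  qed
next
  case (Select v c)
  have "\<eta> r v \<in> local_states I v"
    using Select.prems by (auto simp: states_def PiE_iff)
  then show ?case
    using Select.prems Select.IH[of "c (\<eta> r v)" r "insert v S" "b - 1"] by auto
qed

lemma round_policy_of_policy:
  assumes "legal_from I \<pi> 1 {} b" "t \<ge> 1" "\<forall>i\<in>{1..rounds I} - {t}. \<eta> i \<in> states I"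
  shows "\<exists>q. legal_round I q {} \<and> (\<forall>x. selected \<pi> 1 (\<eta>(t := x)) t = picked q x)"
proof (cases "t = 1")
  case True
  show ?thesis
    using legal_current_round[OF assms(1)] selected_current_round[of \<pi> 1] True
    by (intro exI[of _ "current_round \<pi>"]) auto
qed (use assms selected_depends_on_round[OF assms(1)] in auto)

lemma sum_card_selected_le:
  assumes "legal_from I \<pi> t S b" "finite A"
    "\<forall>i\<in>{1..rounds I}. \<eta> i \<in> states I" "t \<ge> 1"
  shows "(\<Sum>r\<in>A. card (selected \<pi> t \<eta> r)) \<le> b"
  using assms(1,3,4)
proof (induction \<pi> arbitrary: t S b)
  case (Select v c)
  have "\<eta> t v \<in> local_states I v"
    using Select.prems by (auto simp: states_def PiE_iff)
  then have IH: "(\<Sum>r\<in>A. card (selected (c (\<eta> t v)) t \<eta> r)) \<le> b - 1"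
    using Select.prems by (intro Select.IH) auto
  have "(\<Sum>r\<in>A. card (selected (Select v c) t \<eta> r))
    \<le> (\<Sum>r\<in>A. (if r = t then 1 else 0) + card (selected (c (\<eta> t v)) t \<eta> r))"
    by (intro sum_mono) (auto simp: card_insert_if finite_selected)
  also have "\<dots> \<le> 1 + (\<Sum>r\<in>A. card (selected (c (\<eta> t v)) t \<eta> r))"
    using assms(2) by (simp add: sum.distrib)
  also have "\<dots> \<le> b" using IH Select.prems by auto
  finally show ?case .
qed auto

section \<open>Realising budget vectors by chains of single-round trees\<close>

context sbmsm_setting
begin

text \<open>The continuation must be legal for every \<open>S\<close>, since the set selected when
  \<open>q\<close> ends depends on the realization. \<open>Stop\<close> and
  \<open>Next_Round\<close> satisfy this because their legality ignores \<open>S\<close>.\<close>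

lemma legal_run_round:
  assumes "legal_round I q S" "\<forall>\<eta>\<in>states I. card (picked q \<eta>) = k" "k \<le> B" "t \<le> rounds I"
    and "\<And>S. legal_from I K t S (B - k)"
  shows "legal_from I (run_round q K) t S B"
  using assms
proof (induction q arbitrary: S k B)
  case Done
  have "k = 0" using Done.prems(2) states_nonempty by auto
  then show ?case using Done.prems(5)[of S] by simp
next
  case (Pick v c)
  have sub: "Suc (card (picked (c s) \<eta>)) = k" if "s \<in> local_states I v" "\<eta> \<in> states I" for s \<eta>
    using card_picked_subtree[OF Pick.prems(1,2)] that by auto
  obtain \<eta> where \<eta>: "\<eta> \<in> states I" using states_nonempty by auto
  have "k > 0" using Pick.prems(1,2) \<eta> card_picked_Pick[of I v c S \<eta>] by auto
  have "legal_from I (run_round (c s) K) t (insert v S) (B - 1)" if s: "s \<in> local_states I v" for s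
  proof (rule Pick.IH[where k = "k - 1"])
    show "\<forall>\<eta>\<in>states I. card (picked (c s) \<eta>) = k - 1" using sub[OF s] by fastforce
  qed (use Pick.prems \<open>k > 0\<close> s in auto)
  then show ?case using Pick.prems \<open>k > 0\<close> by auto
qed

text \<open>The chain covers all remaining rounds, so its last \<open>Stop\<close> is reached in
  round \<open>rounds I + 1\<close>, where stopping with leftover budget is legal.\<close>

lemma legal_chain:
  assumes "\<forall>r\<in>{t..<t + m}. legal_round I (q r) {} \<and> (\<forall>\<eta>\<in>states I. card (picked (q r) \<eta>) = b r)"
    and "t + m = Suc (rounds I)" "(\<Sum>r\<in>{t..<t + m}. b r) \<le> B"
  shows "legal_from I (chain q b m t B) t {} B"
  using assms
proof (induction m arbitrary: t B)
  case (Suc m)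
  have set: "{t..<t + Suc m} = insert t {Suc t..<Suc t + m}" by auto
  have sum: "b t + (\<Sum>r\<in>{Suc t..<Suc t + m}. b r) \<le> B"
    using Suc.prems(3) unfolding set by simp
  then have "legal_from I (chain q b m (Suc t) (B - b t)) (Suc t) {} (B - b t)"
    using Suc.prems by (intro Suc.IH) auto
  then show ?case
    using Suc.prems sum unfolding chain.simps by (intro legal_run_round[where k = "b t"]) auto
qed simp

lemma selected_chain:
  assumes "\<forall>r\<in>{t..<t + m}. legal_round I (q r) {} \<and> (\<forall>\<eta>\<in>states I. card (picked (q r) \<eta>) = b r)"
    and "(\<Sum>r\<in>{t..<t + m}. b r) \<le> B" "r \<in> {t..<t + m}" "\<forall>r\<in>{t..<t + m}. \<eta> r \<in> states I"
  shows "selected (chain q b m t B) t \<eta> r = picked (q r) (\<eta> r)"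
  using assms
proof (induction m arbitrary: t B)
  case (Suc m)
  have set: "{t..<t + Suc m} = insert t {Suc t..<Suc t + m}" by auto
  have sum: "b t + (\<Sum>r\<in>{Suc t..<Suc t + m}. b r) \<le> B"
    using Suc.prems(2) unfolding set by simp
  show ?case
  proof (cases "r = t")
    case True
    then show ?thesis by (auto simp: selected_run_round selected_before)
  next
    case False
    then have r: "r \<in> {Suc t..<Suc t + m}" using Suc.prems by auto
    show ?thesis
    proof (cases "B = b t")
      case True
      \<comment> \<open>Round \<open>t\<close> uses up the whole budget, so the later rounds have
        budget \<open>0\<close> and stopping early omits no pick.\<close>
      have "b r = 0"
        using sum True member_le_sum[OF r, of b] by simp
      then have "card (picked (q r) (\<eta> r)) = 0"
        using Suc.prems(1,3,4) by (metis (no_types, lifting))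
      then have "picked (q r) (\<eta> r) = {}"
        using finite_picked[of "q r" "\<eta> r"] by simp
      then show ?thesis using True False by (simp add: selected_run_round)
    next
      case neq: False
      have "selected (chain q b m (Suc t) (B - b t)) (Suc t) \<eta> r = picked (q r) (\<eta> r)"
        using Suc.prems sum r by (intro Suc.IH) auto
      then show ?thesis using neq False by (simp add: selected_run_round)
    qed
  qed
qed simp

lemma joint_dist_states:
  "\<eta> \<in> set_pmf (joint_dist I) \<Longrightarrow> t \<in> rounds_set \<Longrightarrow> \<eta> t \<in> states I"
  using state_dist_states by (auto simp: joint_dist_def set_Pi_pmf PiE_dflt_def)

lemma nn_integral_joint_component:
  assumes "t \<in> rounds_set"
  shows "(\<integral>\<^sup>+\<eta>. F (\<eta> t) \<partial>joint_dist I) = (\<integral>\<^sup>+x. F x \<partial>state_dist I t)"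
proof -
  have "state_dist I t = map_pmf (\<lambda>\<eta>. \<eta> t) (joint_dist I)"
    using assms unfolding joint_dist_def by (subst Pi_pmf_component) auto
  then show ?thesis by simp
qed

lemma round_opt_nonempty:
  assumes "k \<le> card (items I)"
  shows "\<exists>q. legal_round I q {} \<and> (\<forall>\<eta>\<in>states I. card (picked q \<eta>) = k)"
  using pad_props[of I Done "{}" k] assms finite_items by auto

section \<open>Comparing adaptive with partially adaptive values\<close>

definition partial_opt :: ennreal where
  "partial_opt = (SUP \<pi>\<in>partially_adaptive_policies I. policy_value I \<pi>)"

text \<open>Single-round trees with fixed numbers of picks, chained together, form a partially
  adaptive policy whose value is the sum of theirs. \<open>sum_SUP_le\<close> passes to the suprema,
  so no optimal trees have to be chosen.\<close>

lemma sum_round_opt_le: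
  assumes b: "\<And>t. t \<in> rounds_set \<Longrightarrow> b t \<le> card (items I)" and sum: "(\<Sum>t\<in>rounds_set. b t) \<le> budget I"
  shows "(\<Sum>t\<in>rounds_set. round_opt I t (b t)) \<le> partial_opt"
proof -
  let ?Q = "\<lambda>t. {q. legal_round I q {} \<and> (\<forall>\<eta>\<in>states I. card (picked q \<eta>) = b t)}"
  let ?F = "\<lambda>t q. \<integral>\<^sup>+\<eta>. ennreal (reward I t (picked q \<eta>) \<eta>) \<partial>state_dist I t"
  have "0 + (\<Sum>t\<in>rounds_set. SUP q\<in>?Q t. ?F t q) \<le> partial_opt"
  proof (rule sum_SUP_le)
    show "?Q t \<noteq> {}" if "t \<in> rounds_set" for t
      using round_opt_nonempty[OF b[OF that]] by auto
  next
    fix q assume q: "\<And>t. t \<in> rounds_set \<Longrightarrow> q t \<in> ?Q t"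
    let ?\<pi> = "chain q b (rounds I) 1 (budget I)"
    have set: "rounds_set = {1..<1 + rounds I}" by auto
    have q': "\<forall>r\<in>{1..<1 + rounds I}. legal_round I (q r) {} \<and> (\<forall>\<eta>\<in>states I. card (picked (q r) \<eta>) = b r)"
      using q by auto
    have sum': "(\<Sum>r\<in>{1..<1 + rounds I}. b r) \<le> budget I" using sum set by simp
    have sel: "selected ?\<pi> 1 \<eta> t = picked (q t) (\<eta> t)"
      if "\<forall>r\<in>rounds_set. \<eta> r \<in> states I" "t \<in> rounds_set" for t \<eta>
      using that set by (intro selected_chain[OF q' sum']) auto
    have "?\<pi> \<in> adaptive_policies I"
      using legal_chain[OF q' _ sum'] by (simp add: adaptive_policies_def)
    moreover have "\<forall>\<eta>\<in>rounds_set \<rightarrow> states I. \<forall>t\<in>rounds_set. card (selected ?\<pi> 1 \<eta> t) = b t"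
    proof (intro ballI)
      fix \<eta> t assume \<eta>: "\<eta> \<in> rounds_set \<rightarrow> states I" and t: "t \<in> rounds_set"
      then have "selected ?\<pi> 1 \<eta> t = picked (q t) (\<eta> t)" by (intro sel) auto
      moreover have "\<eta> t \<in> states I" using \<eta> t by auto
      ultimately show "card (selected ?\<pi> 1 \<eta> t) = b t" using q[OF t] by simp
    qed
    ultimately have "?\<pi> \<in> partially_adaptive_policies I"
      using sum by (auto simp: partially_adaptive_policies_def)
    moreover have "policy_value I ?\<pi> = (\<Sum>t\<in>rounds_set. ?F t (q t))"
    proof -
      have "policy_value I ?\<pi>
        = (\<integral>\<^sup>+\<eta>. (\<Sum>t\<in>rounds_set. ennreal (reward I t (picked (q t) (\<eta> t)) (\<eta> t))) \<partial>joint_dist I)"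
        unfolding policy_value_def
        using sel joint_dist_states by (intro nn_integral_cong_AE) (simp add: AE_measure_pmf_iff)
      also have "\<dots> = (\<Sum>t\<in>rounds_set. ?F t (q t))"
        by (subst nn_integral_sum) (auto intro!: sum.cong nn_integral_joint_component)
      finally show ?thesis .
    qed
    ultimately show "0 + (\<Sum>t\<in>rounds_set. ?F t (q t)) \<le> partial_opt"
      unfolding partial_opt_def by (auto intro: SUP_upper2)
  qed simp
  then show ?thesis by (simp add: round_opt_def)
qed

text \<open>With the other rounds fixed, \<open>round_value_le\<close> bounds round
  \<open>t\<close>. Averaging and summing leaves \<open>c\<close> times the expected total number of
  picks, which is at most the budget because every realization respects it.\<close>

lemma policy_value_le:
  assumes \<pi>: "\<pi> \<in> adaptive_policies I"
    and b: "\<And>t. t \<in> rounds_set \<Longrightarrow> b t \<le> card (items I)"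
    and c: "\<And>t. t \<in> rounds_set \<Longrightarrow> b t = card (items I) \<or> round_opt I t (b t + 1) \<le> c * of_nat (b t + 1)"
  shows "policy_value I \<pi> \<le> (\<Sum>t\<in>rounds_set. round_opt I t (b t)) + c * of_nat (budget I)"
proof -
  let ?J = "joint_dist I"
  let ?r = "\<lambda>t \<eta>. ennreal (reward I t (selected \<pi> 1 \<eta> t) (\<eta> t))"
  let ?k = "\<lambda>t \<eta>. of_nat (card (selected \<pi> 1 \<eta> t)) :: ennreal"
  have legal: "legal_from I \<pi> 1 {} (budget I)" using \<pi> by (simp add: adaptive_policies_def)
  have round: "(\<integral>\<^sup>+\<eta>. ?r t \<eta> \<partial>?J) \<le> round_opt I t (b t) + c * (\<integral>\<^sup>+\<eta>. ?k t \<eta> \<partial>?J)"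
    if t: "t \<in> rounds_set" for t
  proof -
    have fix_round: "(\<integral>\<^sup>+\<eta>. F \<eta> \<partial>?J) = (\<integral>\<^sup>+\<eta>. (\<integral>\<^sup>+x. F (\<eta>(t := x)) \<partial>state_dist I t) \<partial>?J)"
      for F :: "_ \<Rightarrow> ennreal"
      unfolding joint_dist_def using t by (intro nn_integral_Pi_pmf_fix) auto
    have "(\<integral>\<^sup>+\<eta>. ?r t \<eta> \<partial>?J) = (\<integral>\<^sup>+\<eta>. (\<integral>\<^sup>+x. ?r t (\<eta>(t := x)) \<partial>state_dist I t) \<partial>?J)"
      by (rule fix_round)
    also have "\<dots> \<le> (\<integral>\<^sup>+\<eta>. round_opt I t (b t) + c * (\<integral>\<^sup>+x. ?k t (\<eta>(t := x)) \<partial>state_dist I t) \<partial>?J)"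
    proof (intro nn_integral_mono_AE, simp only: AE_measure_pmf_iff, intro ballI)
      fix \<eta> assume "\<eta> \<in> set_pmf ?J"
      then have "\<forall>i\<in>rounds_set - {t}. \<eta> i \<in> states I" using joint_dist_states by auto
      then obtain q where q: "legal_round I q {}" "\<And>x. selected \<pi> 1 (\<eta>(t := x)) t = picked q x"
        using round_policy_of_policy[OF legal, of t \<eta>] t by auto
      show "(\<integral>\<^sup>+x. ?r t (\<eta>(t := x)) \<partial>state_dist I t)
        \<le> round_opt I t (b t) + c * (\<integral>\<^sup>+x. ?k t (\<eta>(t := x)) \<partial>state_dist I t)"
        using round_value_le[OF t b[OF t] q(1) c[OF t]] by (simp only: q(2) fun_upd_same)
    qed
    also have "\<dots> = round_opt I t (b t) + c * (\<integral>\<^sup>+\<eta>. (\<integral>\<^sup>+x. ?k t (\<eta>(t := x)) \<partial>state_dist I t) \<partial>?J)"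
      by (subst nn_integral_add) (simp_all add: nn_integral_cmult)
    also have "(\<integral>\<^sup>+\<eta>. (\<integral>\<^sup>+x. ?k t (\<eta>(t := x)) \<partial>state_dist I t) \<partial>?J) = (\<integral>\<^sup>+\<eta>. ?k t \<eta> \<partial>?J)"
      by (rule fix_round[symmetric])
    finally show ?thesis .
  qed
  have "policy_value I \<pi> = (\<Sum>t\<in>rounds_set. \<integral>\<^sup>+\<eta>. ?r t \<eta> \<partial>?J)"
    unfolding policy_value_def by (rule nn_integral_sum) simp
  also have "\<dots> \<le> (\<Sum>t\<in>rounds_set. round_opt I t (b t) + c * (\<integral>\<^sup>+\<eta>. ?k t \<eta> \<partial>?J))"
    by (rule sum_mono) (rule round)
  also have "\<dots> = (\<Sum>t\<in>rounds_set. round_opt I t (b t)) + c * (\<Sum>t\<in>rounds_set. \<integral>\<^sup>+\<eta>. ?k t \<eta> \<partial>?J)"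
    by (simp add: sum.distrib sum_distrib_left)
  also have "(\<Sum>t\<in>rounds_set. \<integral>\<^sup>+\<eta>. ?k t \<eta> \<partial>?J) = (\<integral>\<^sup>+\<eta>. (\<Sum>t\<in>rounds_set. ?k t \<eta>) \<partial>?J)"
    by (rule nn_integral_sum[symmetric]) simp
  also have "\<dots> \<le> (\<integral>\<^sup>+\<eta>. of_nat (budget I) \<partial>?J)"
  proof (intro nn_integral_mono_AE, simp only: AE_measure_pmf_iff, intro ballI)
    fix \<eta> assume "\<eta> \<in> set_pmf ?J"
    then have "(\<Sum>t\<in>rounds_set. card (selected \<pi> 1 \<eta> t)) \<le> budget I"
      using joint_dist_states by (intro sum_card_selected_le[OF legal]) auto
    then show "(\<Sum>t\<in>rounds_set. ?k t \<eta>) \<le> of_nat (budget I)"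
      unfolding of_nat_sum[symmetric] by (rule of_nat_mono)
  qed
  also have "\<dots> = of_nat (budget I)" by simp
  finally show ?thesis by (simp add: add_left_mono mult_left_mono)
qed

text \<open>
  The price is \<open>c = partial_opt / B\<close>, and \<open>b t\<close> is the least length whose successor is not worth its
  price.  If \<open>b\<close> exceeded the budget, shrinking it to total \<open>B\<close> would give a budget vector in which
  every nonempty round is worth strictly more than its price, so more than \<open>partial_opt\<close> in total.
\<close>

lemma adaptive_le_twice_partial:
  assumes \<pi>: "\<pi> \<in> adaptive_policies I"
  shows "policy_value I \<pi> \<le> 2 * partial_opt"
\<comment> \<open>The price needs a nonzero divisor and must be finite. With budget \<open>0\<close>
  the only adaptive policy is \<open>Stop\<close>; an infinite \<open>partial_opt\<close> makes the
  claim trivial.\<close>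
proof (cases "budget I = 0 \<or> partial_opt = \<top>")
  case True
  show ?thesis
  proof (cases "partial_opt = \<top>")
    case False
    have "\<pi> = Stop"
      using \<pi> True False by (cases \<pi>) (auto simp: adaptive_policies_def)
    then have "\<pi> \<in> partially_adaptive_policies I"
      using \<pi> by (auto simp: partially_adaptive_policies_def intro!: exI[of _ "\<lambda>_. 0"])
    then have "policy_value I \<pi> \<le> partial_opt" unfolding partial_opt_def by (rule SUP_upper)
    then show ?thesis by (simp add: mult_2 add_increasing2)
  qed (simp add: ennreal_mult_top)
next
  case False
  let ?n = "card (items I)" and ?B = "budget I"
  define c where "c = partial_opt / of_nat ?B"
  have cB: "c * of_nat ?B = partial_opt" and c: "c \<noteq> \<top>"
    using False
    by (auto simp: c_def ennreal_divide_times ennreal_divide_eq_top_iff of_nat_less_top)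
  \<comment> \<open>The disjunct \<open>k = ?n\<close> ensures that a least \<open>k\<close> exists
    and is at most \<open>?n\<close>.\<close>
  define b where "b t = (LEAST k. k = ?n \<or> round_opt I t (k + 1) \<le> c * of_nat (k + 1))" for t
  have b: "b t = ?n \<or> round_opt I t (b t + 1) \<le> c * of_nat (b t + 1)" for t
    unfolding b_def by (rule LeastI[of _ ?n]) simp
  have bn: "b t \<le> ?n" for t
    unfolding b_def by (rule Least_le) simp
  have worth: "c * of_nat k < round_opt I t k" if "0 < k" "k \<le> b t" for t k
  proof -
    \<comment> \<open>Minimality of \<open>b t\<close> is applied to \<open>k - 1\<close>, as the
      defining condition concerns length \<open>k - 1 + 1\<close>.\<close>
    have "k - 1 < b t" using that by auto
    from not_less_Least[OF this[unfolded b_def]] show ?thesis using that by (simp add: not_le)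
  qed
  have "(\<Sum>t\<in>rounds_set. b t) \<le> ?B"
  proof (rule ccontr)
    assume "\<not> ?thesis"
    then have "?B \<le> sum b rounds_set" by simp
    then obtain b' where b': "\<And>t. b' t \<le> b t" "sum b' rounds_set = ?B"
      by (rule bounded_subsum[OF finite_atLeastAtMost]) (rule that)
    \<comment> \<open>The budget is positive here, so some round has a positive share and yields the
      strict inequality.\<close>
    then obtain r where r: "r \<in> rounds_set" "b' r > 0"
      using False by (metis (no_types, lifting) gr0I sum.neutral)
    have le: "c * of_nat (b' t) \<le> round_opt I t (b' t)" for t
      using worth[of "b' t" t] b'(1)[of t] by (cases "b' t = 0") auto
    let ?R = "rounds_set - {r}"
    have "partial_opt = (\<Sum>t\<in>rounds_set. c * of_nat (b' t))"
      unfolding cB[symmetric] b'(2)[symmetric] by (simp add: sum_distrib_left)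
    also have "\<dots> = c * of_nat (b' r) + (\<Sum>t\<in>?R. c * of_nat (b' t))"
      using r(1) by (intro sum.remove) auto
    also have "\<dots> < round_opt I r (b' r) + (\<Sum>t\<in>?R. c * of_nat (b' t))"
    proof -
      \<comment> \<open>Strictness survives adding the other rounds only because their total price
        is finite.\<close>
      have "(\<Sum>t\<in>?R. c * of_nat (b' t)) \<noteq> \<top>"
        using c by (simp add: ennreal_mult_eq_top_iff)
      then show ?thesis
        using worth[of "b' r" r] r b'(1)[of r]
        by (subst (1 2) add.commute) (simp add: ennreal_add_left_cancel_less)
    qed
    also have "\<dots> \<le> round_opt I r (b' r) + (\<Sum>t\<in>?R. round_opt I t (b' t))"
      by (intro add_left_mono sum_mono le)
    also have "\<dots> = (\<Sum>t\<in>rounds_set. round_opt I t (b' t))"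
      using r(1) by (intro sum.remove[symmetric]) auto
    also have "\<dots> \<le> partial_opt"
      using b' bn by (intro sum_round_opt_le) (auto intro: order_trans)
    finally show False by simp
  qed
  then have "(\<Sum>t\<in>rounds_set. round_opt I t (b t)) \<le> partial_opt"
    using bn by (intro sum_round_opt_le) auto
  then have "(\<Sum>t\<in>rounds_set. round_opt I t (b t)) + c * of_nat ?B \<le> 2 * partial_opt"
    unfolding cB by (simp add: mult_2 add_right_mono)
  then show ?thesis
    using policy_value_le[OF \<pi>, of b c] bn b by (auto intro: order_trans)
qed

end

section \<open>From the setting to the gap\<close>

lemma sbmsm_settingI:
  assumes "sbmsm_instance I" "standing_assumptions sz p I"
  shows "sbmsm_setting I"
proof
  show "\<exists>L. \<forall>t\<in>{1..rounds I}. \<forall>S\<subseteq>items I. \<forall>v\<in>items I. \<forall>\<eta>\<in>states I.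
      reward I t (insert v S) \<eta> - reward I t S \<eta> \<le> L"
    using assms(2) unfolding standing_assumptions_def polynomially_bounded_def by (elim conjE exE) (rule exI)
qed (use assms in \<open>auto simp: standing_assumptions_def\<close>)

lemma budget_adaptivity_gap_le:
  assumes "sbmsm_setting I"
  shows "budget_adaptivity_gap I \<le> 2"
proof -
  let ?X = "SUP \<pi>\<in>partially_adaptive_policies I. policy_value I \<pi>"
  have "(SUP \<pi>\<in>adaptive_policies I. policy_value I \<pi>) \<le> 2 * ?X"
    using sbmsm_setting.adaptive_le_twice_partial[OF assms]
    unfolding sbmsm_setting.partial_opt_def[OF assms] by (intro SUP_least)
  then have "budget_adaptivity_gap I \<le> 2 * ?X / ?X"
    unfolding budget_adaptivity_gap_def by (rule divide_right_mono_ennreal)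
  also have "\<dots> \<le> 2"
  \<comment> \<open>For \<open>?X\<close> zero or infinite the quotient is \<open>0\<close> by
    convention; otherwise \<open>?X\<close> cancels.\<close>
  proof (cases ?X rule: ennreal_cases)
    case (real r)
    then show ?thesis
      by (cases "r = 0") (simp_all flip: ennreal_times_divide)
  qed (simp only: ennreal_divide_top, simp)
  finally show ?thesis .
qed

theorem theorem3:
  fixes sz :: "('v, 's) sbmsm \<Rightarrow> nat" and p :: "real poly"
  shows "(\<forall>(I :: ('v, 's) sbmsm) \<pi>_opt \<pi>.
            sbmsm_instance I \<longrightarrow> standing_assumptions sz p I \<longrightarrow>
            optimal_in I (adaptive_policies I) \<pi>_opt \<longrightarrow>
            optimal_in I (partially_adaptive_policies I) \<pi> \<longrightarrow>
            policy_value I \<pi>_opt \<le> 2 * policy_value I \<pi>) \<and>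
         sbmsm_gap sz p \<le> 2"
proof (intro conjI allI impI)
  fix I :: "('v, 's) sbmsm" and \<pi>_opt \<pi>
  assume "sbmsm_instance I" "standing_assumptions sz p I"
    and opt: "optimal_in I (adaptive_policies I) \<pi>_opt" "optimal_in I (partially_adaptive_policies I) \<pi>"
  then interpret sbmsm_setting I by (intro sbmsm_settingI)
  have "policy_value I \<pi>_opt \<le> 2 * partial_opt"
    using opt by (intro adaptive_le_twice_partial) (simp add: optimal_in_def)
  also have "\<dots> \<le> 2 * policy_value I \<pi>"
    using opt unfolding partial_opt_def by (intro mult_left_mono SUP_least) (auto simp: optimal_in_def)
  finally show "policy_value I \<pi>_opt \<le> 2 * policy_value I \<pi>" .
next
  show "sbmsm_gap sz p \<le> 2"
    unfolding sbmsm_gap_def by (intro SUP_least budget_adaptivity_gap_le) (auto intro: sbmsm_settingI)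
qed

end
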